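(* Let $n\ge 2$, let $W\subseteq [n]$, let $W=W_1\sqcup\cdots\sqcup W_k$ be a partition of $W$, and let $G=F_k^W(K_n)$ be a $k$-fan graph of the complete graph $K_n$ on the set $W$ (with respect to this partition). Let $S=\mathbb{K}[x_u : u\in V(G)]$ and let $I_G\subset S$ be the edge ideal of $G$. Then $$\dim(S/I_G)=\begin{cases} |W|+1 & \text{if } W\subsetneq [n];\\ n & \text{if } W=[n].\end{cases}$$
   Context: $\mathbb{K}$ is a field; $[n]=\{1,\dots,n\}$. For a finite simple graph $G$ the edge ideal is $I_G=(x_ux_v : \{u,v\}\in E(G))\subset S=\mathbb{K}[x_u:u\in V(G)]$. $\dim$ is Krull dimension. Fan graphs: let $K_n$ be the complete graph on $[n]$. Given $U=\{u_1,\dots,u_r\}\subseteq[n]$ (with a chosen ordering), suppose that for each $i\in[r]$ a new complete graph $K_{a_i}$ on $a_i>i$ vertices is attached to $K_n$ in such a way that $V(K_n)\cap V(K_{a_i})=\{u_1,\dots,u_i\}$ (the new vertices of different attached cliques are pairwise distinct). The resulting graph is said to be obtained by adding a fan to $K_n$ on $U$, and $\{K_{a_1},\dots,K_{a_r}\}$ is the branch of that fan on $U$. If $W\subseteq[n]$ and $W=W_1\sqcup\cdots\sqcup W_k$ is a partition into nonempty subsets, a $k$-fan graph $F_k^W(K_n)$ of $K_n$ on $W$ is a graph obtained from $K_n$ by adding a fan on each $W_i$. The complete graph $K_n$ itself is regarded as the degenerate case $k=0$, $W=\emptyset$. *)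

theory Defs
  imports
    "HOL-Algebra.QuotRing"
    "HOL-Library.Poly_Mapping"
    "HOL-Library.Disjoint_Sets"
    "HOL-Library.Extended_Real"
begin

section \<open>Krull dimension\<close>

text \<open>
  The supremum of the lengths \<open>l\<close> of strictly increasing chains
  \<open>P 0 \<subset> P 1 \<subset> \<dots> \<subset> P l\<close> of prime ideals. Only the values \<open>P 0, \<dots>, P l\<close> matter.
  The supremum is taken in the extended reals, so that the zero ring has dimension \<open>-\<infinity>\<close>.
\<close>

definition krull_dim :: "('a, 'm) ring_scheme \<Rightarrow> ereal" where
  "krull_dim R =
     Sup {ereal (real l) | l. \<exists>P :: nat \<Rightarrow> 'a set.
            (\<forall>i\<le>l. primeideal (P i) R) \<and> (\<forall>i<l. P i \<subset> P (Suc i))}"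


section \<open>Polynomial rings and edge ideals\<close>

text \<open>
  A monomial is a finitely supported exponent vector \<open>'v \<Rightarrow>\<^sub>0 nat\<close>, a polynomial a finitely
  supported map from monomials to coefficients. The polynomial ring in the variables
  \<open>x\<^sub>v\<close>, \<open>v \<in> V\<close>, consists of the polynomials all of whose monomials only involve variables
  in \<open>V\<close>.
\<close>

type_synonym ('v, 'k) polynomial = "('v \<Rightarrow>\<^sub>0 nat) \<Rightarrow>\<^sub>0 'k"

definition polynomial_ring :: "'v set \<Rightarrow> ('v, 'k::comm_ring_1) polynomial ring" where
  "polynomial_ring V =
     \<lparr>carrier = {p. \<forall>m \<in> Poly_Mapping.keys p. Poly_Mapping.keys m \<subseteq> V},
      monoid.mult = (*), one = 1, zero = 0, add = (+)\<rparr>"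

definition Var :: "'v \<Rightarrow> ('v, 'k::comm_ring_1) polynomial" where
  "Var v = Poly_Mapping.single (Poly_Mapping.single v 1) 1"

text \<open>A graph is a pair of its vertex set and its set of edges, which are two-element sets.\<close>

type_synonym 'v ugraph = "'v set \<times> 'v set set"

abbreviation verts :: "'v ugraph \<Rightarrow> 'v set" where "verts \<equiv> fst"
abbreviation edges :: "'v ugraph \<Rightarrow> 'v set set" where "edges \<equiv> snd"

definition edge_ideal :: "'v ugraph \<Rightarrow> ('v, 'k::comm_ring_1) polynomial set" where
  "edge_ideal G = Idl\<^bsub>polynomial_ring (verts G)\<^esub> {Var u * Var v | u v. {u, v} \<in> edges G}"


section \<open>Fan graphs\<close>

definition complete_graph :: "'v set \<Rightarrow> 'v ugraph" where
  "complete_graph A = (A, {{u, v} | u v. u \<in> A \<and> v \<in> A \<and> u \<noteq> v})"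

definition graph_Union :: "'v ugraph set \<Rightarrow> 'v ugraph" where
  "graph_Union \<G> = (\<Union>G\<in>\<G>. verts G, \<Union>G\<in>\<G>. edges G)"

text \<open>
  \<open>fan_branch C us B\<close>: the list \<open>B\<close> consists of the vertex sets of the cliques
  \<open>K\<^bsub>a\<^sub>1\<^esub>, \<dots>, K\<^bsub>a\<^sub>r\<^esub>\<close> of a branch of a fan added to the complete graph on \<open>C\<close> along the ordered set
  \<open>us = [u\<^sub>1, \<dots>, u\<^sub>r]\<close>. List indices start at \<open>0\<close>, so that \<open>B ! i\<close> belongs to \<open>a\<^bsub>i+1\<^esub>\<close>.
  The last condition says that distinct cliques of the branch share no new vertex.
\<close>

definition fan_branch :: "'v set \<Rightarrow> 'v list \<Rightarrow> 'v set list \<Rightarrow> bool" where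
  "fan_branch C us B \<longleftrightarrow>
     distinct us \<and> set us \<subseteq> C \<and> length B = length us \<and>
     (\<forall>i < length us. finite (B ! i) \<and> card (B ! i) > Suc i \<and>
        C \<inter> B ! i = set (take (Suc i) us)) \<and>
     (\<forall>i < length us. \<forall>j < length us. i \<noteq> j \<longrightarrow> B ! i \<inter> B ! j \<subseteq> C)"

text \<open>
  \<open>k_fan_graph n k W P G\<close>: \<open>G\<close> is a \<open>k\<close>-fan graph of \<open>K\<^sub>n\<close> (on the vertices \<open>1, \<dots>, n\<close>) on \<open>W\<close> with
  respect to the partition \<open>P\<close> of \<open>W\<close> into \<open>k\<close> nonempty parts. The ordering \<open>us U\<close> of each part \<open>U\<close>
  and the branch \<open>B U\<close> of the fan on \<open>U\<close> can be chosen freely, as long as different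
  fans share no new vertex. New vertices are natural numbers outside \<open>{1..n}\<close>; as fan graphs are
  finite, this is only a choice of vertex names.
\<close>

definition k_fan_graph :: "nat \<Rightarrow> nat \<Rightarrow> nat set \<Rightarrow> nat set set \<Rightarrow> nat ugraph \<Rightarrow> bool" where
  "k_fan_graph n k W P G \<longleftrightarrow>
     W \<subseteq> {1..n} \<and> partition_on W P \<and> card P = k \<and>
     (\<exists>us B.
        (\<forall>U\<in>P. set (us U) = U \<and> fan_branch {1..n} (us U) (B U)) \<and>
        (\<forall>U\<in>P. \<forall>U'\<in>P. U \<noteq> U' \<longrightarrow> \<Union>(set (B U)) \<inter> \<Union>(set (B U')) \<subseteq> {1..n}) \<and>
        G = graph_Union (complete_graph ` insert {1..n} (\<Union>U\<in>P. set (B U))))"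

end

theory Submission
  imports Defs
begin

text \<open>
  The proof has an algebraic and a combinatorial half, which meet at the independence number of \<open>G\<close>,
  the maximal size of a set of pairwise nonadjacent vertices.

  The Krull dimension of the quotient by an edge ideal is the independence number, for every finite
  graph (\<open>krull_dim_edge_ideal\<close>). By the correspondence theorem (\<open>krull_dim_quotient\<close>), it is a matter
  of chains of primes of the polynomial ring that start above the edge ideal. An
  independent set gives a chain of primes generated by variables. For the upper bound, the variables
  that do not belong to the first prime of a chain form an independent set \<open>J\<close>, and the
  chain cannot be longer than \<open>card J\<close> (\<open>prime_chain_length_le\<close>).

  The last point is the inequality \<open>dim K[x\<^sub>1, \<dots>, x\<^sub>d] \<le> d\<close>, for which a direct argument takes the place of the theory
  of transcendence degree or of Noether normalization.
  In a chain \<open>Q\<^sub>0 \<subset> \<dots> \<subset> Q\<^sub>l\<close> choose \<open>y\<^sub>i \<in> Q\<^bsub>i+1\<^esub> - Q\<^sub>i\<close>. For \<open>l > d\<close> there is an algebraic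
  relation between \<open>y\<^sub>0, \<dots>, y\<^bsub>l-1\<^esub>\<close>, because their power products outnumber the monomials in \<open>d\<close> variables
  that they involve (\<open>algebraic_dependence\<close>). Its lexicographically least
  term survives all primes of the chain and makes the last one contain a nonzero constant
  (\<open>no_algebraic_relation_along_chain\<close>).

  The independence number of a fan graph is found by exhibiting an independent set and a cover of the vertices by
  equally many cliques (\<open>fan_graph_maximum_independent_set\<close>): an independent
  set meets every clique in at most one vertex.
\<close>

section \<open>Krull dimension of a quotient ring\<close>

text \<open>
  As \<open>Q\<close> contains \<open>I\<close>, it is a union of cosets of \<open>I\<close>, so membership of a coset in the image of \<open>Q\<close>
  can be tested on any representative, and all properties of \<open>Q\<close> carry over.
\<close>

lemma primeideal_quotient_image:
  assumes "cring R" "ideal I R" "primeideal Q R" "I \<subseteq> Q"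
  shows "primeideal ((+>\<^bsub>R\<^esub>) I ` Q) (R Quot I)"
proof -
  interpret R: cring R by fact
  interpret I: ideal I R by fact
  interpret Q: primeideal Q R by fact
  have mem: "I +>\<^bsub>R\<^esub> r \<in> (+>\<^bsub>R\<^esub>) I ` Q \<longleftrightarrow> r \<in> Q" if "r \<in> carrier R" for r
  proof -
    have "ideal ((+>\<^bsub>R\<^esub>) I ` Q) (R Quot I)"
      by (rule R.ring_ideal_imp_quot_ideal[OF assms(2) Q.is_ideal])
    then have "r \<in> \<Union> ((+>\<^bsub>R\<^esub>) I ` Q) \<longleftrightarrow> I +>\<^bsub>R\<^esub> r \<in> (+>\<^bsub>R\<^esub>) I ` Q"
      by (intro R.canonical_proj_vimage_mem_iff[OF assms(2) _ that] additive_subgroup.a_subset ideal.axioms(1))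
    moreover have "Q = \<Union> ((+>\<^bsub>R\<^esub>) I ` Q)"
      using R.ideal_incl_iff[OF assms(2) Q.is_ideal] assms(4) by (rule iffD1)
    ultimately show ?thesis by simp
  qed
  show ?thesis
  proof (rule primeidealI)
    show "ideal ((+>\<^bsub>R\<^esub>) I ` Q) (R Quot I)"
      by (rule R.ring_ideal_imp_quot_ideal[OF assms(2) Q.is_ideal])
    show "cring (R Quot I)"
      using I.quotient_is_cring[OF assms(1)] .
  next
    obtain r where r: "r \<in> carrier R" "r \<notin> Q"
      using Q.I_notcarr Q.a_subset by blast
    have "I +>\<^bsub>R\<^esub> r \<in> carrier (R Quot I)"
      using r by (auto simp: FactRing_def A_RCOSETS_def')
    then show "carrier (R Quot I) \<noteq> (+>\<^bsub>R\<^esub>) I ` Q"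
      using mem[OF r(1)] r(2) by auto
  next
    fix X Y assume "X \<in> carrier (R Quot I)" "Y \<in> carrier (R Quot I)"
    then obtain x y where xy: "x \<in> carrier R" "X = I +>\<^bsub>R\<^esub> x" "y \<in> carrier R" "Y = I +>\<^bsub>R\<^esub> y"
      by (auto simp: FactRing_def A_RCOSETS_def')
    assume "X \<otimes>\<^bsub>R Quot I\<^esub> Y \<in> (+>\<^bsub>R\<^esub>) I ` Q"
    then have "I +>\<^bsub>R\<^esub> (x \<otimes>\<^bsub>R\<^esub> y) \<in> (+>\<^bsub>R\<^esub>) I ` Q"
      using xy by (simp add: FactRing_def I.rcoset_mult_add)
    then have "x \<otimes>\<^bsub>R\<^esub> y \<in> Q"
      using mem xy by simp
    then show "X \<in> (+>\<^bsub>R\<^esub>) I ` Q \<or> Y \<in> (+>\<^bsub>R\<^esub>) I ` Q"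
      using Q.I_prime xy mem by auto
  qed
qed

text \<open>
  The correspondence theorem: preimage and image under the projection translate chains of primes of
  the quotient into chains of primes containing \<open>I\<close>, and back, and both preserve strict inclusions.
  All later work thus takes place among honest polynomials instead of cosets.
\<close>

lemma krull_dim_quotient:
  assumes R: "cring R" and I: "ideal I R"
  shows "krull_dim (R Quot I) =
     Sup {ereal (real l) | l. \<exists>Q :: nat \<Rightarrow> _ set. I \<subseteq> Q 0 \<and>
            (\<forall>i\<le>l. primeideal (Q i) R) \<and> (\<forall>i<l. Q i \<subset> Q (Suc i))}"
proof -
  interpret R: cring R by fact
  interpret I: ideal I R by fact
  have up: "\<exists>Q. I \<subseteq> Q 0 \<and> (\<forall>i\<le>l. primeideal (Q i) R) \<and> (\<forall>i<l. Q i \<subset> Q (Suc i))"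
    if P: "\<forall>i\<le>l. primeideal (P i) (R Quot I)" "\<forall>i<l. P i \<subset> P (Suc i)" for P l
  proof -
    have P_carr: "P i \<subseteq> carrier (R Quot I)" if "i \<le> l" for i
    proof -
      interpret P: primeideal "P i" "R Quot I" using P that by simp
      show ?thesis by (rule P.a_subset)
    qed
    have P0: "I \<in> P 0"
    proof -
      interpret P: primeideal "P 0" "R Quot I" using P by simp
      show ?thesis
        using additive_subgroup.zero_closed[OF P.additive_subgroup_axioms] by (simp add: FactRing_def)
    qed
    define Q where "Q i = {r \<in> carrier R. I +>\<^bsub>R\<^esub> r \<in> P i}" for i
    have "I \<subseteq> Q 0"
      using P0 I.a_rcos_const I.a_subset by (auto simp: Q_def)
    moreover have "primeideal (Q i) R" if "i \<le> l" for i
      unfolding Q_def using ring_hom_ring.primeideal_vimage[OF I.rcos_ring_hom_ring R] P that by simp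
    moreover have "Q i \<subset> Q (Suc i)" if il: "i < l" for i
    proof -
      have P_i: "P i \<subset> P (Suc i)" using P(2) il by simp
      obtain X where X: "X \<in> P (Suc i)" "X \<notin> P i"
        using P_i by (auto dest: psubset_imp_ex_mem)
      have "X \<in> carrier (R Quot I)"
        using subsetD[OF P_carr[OF Suc_leI[OF il]] X(1)] .
      then obtain r where "r \<in> carrier R" "X = I +>\<^bsub>R\<^esub> r"
        by (auto simp: FactRing_def A_RCOSETS_def')
      then have "r \<in> Q (Suc i)" "r \<notin> Q i"
        using X by (simp_all add: Q_def)
      moreover have "Q i \<subseteq> Q (Suc i)"
        using psubset_imp_subset[OF P_i] by (auto simp: Q_def)
      ultimately show ?thesis by (metis psubsetI)
    qed
    ultimately show ?thesis by blast
  qed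
  have down: "\<exists>P. (\<forall>i\<le>l. primeideal (P i) (R Quot I)) \<and> (\<forall>i<l. P i \<subset> P (Suc i))"
    if Q: "I \<subseteq> Q 0" "\<forall>i\<le>l. primeideal (Q i) R" "\<forall>i<l. Q i \<subset> Q (Suc i)" for Q l
  proof -
    have I_le: "I \<subseteq> Q i" if "i \<le> l" for i
      using that
    proof (induction i)
      case (Suc i)
      then show ?case using Q(3) by (meson Suc_le_eq less_imp_le_nat psubset_imp_subset subset_trans)
    qed (use Q in simp)
    have "(+>\<^bsub>R\<^esub>) I ` Q i \<subset> (+>\<^bsub>R\<^esub>) I ` Q (Suc i)" if "i < l" for i
    proof -
      have inj: "inj_on (\<lambda>J. (+>\<^bsub>R\<^esub>) I ` J) {J. ideal J R \<and> I \<subseteq> J}"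
        using R.quot_ideal_correspondence[OF I] by (simp add: bij_betw_def)
      have "ideal (Q i) R" "ideal (Q (Suc i)) R"
        using Q that by (simp_all add: primeideal.axioms(1))
      then have "(+>\<^bsub>R\<^esub>) I ` Q i \<noteq> (+>\<^bsub>R\<^esub>) I ` Q (Suc i)"
        using inj_onD[OF inj, of "Q i" "Q (Suc i)"] I_le[of i] I_le[of "Suc i"] Q(3) that by auto
      then show ?thesis using Q(3) that by blast
    qed
    moreover have "primeideal ((+>\<^bsub>R\<^esub>) I ` Q i) (R Quot I)" if "i \<le> l" for i
      using primeideal_quotient_image[OF R I] Q that I_le by simp
    ultimately show ?thesis by (intro exI[of _ "\<lambda>i. (+>\<^bsub>R\<^esub>) I ` Q i"]) simp
  qed
  have eq: "(\<exists>P :: nat \<Rightarrow> _. (\<forall>i\<le>l. primeideal (P i) (R Quot I)) \<and> (\<forall>i<l. P i \<subset> P (Suc i))) \<longleftrightarrow>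
      (\<exists>Q :: nat \<Rightarrow> _. I \<subseteq> Q 0 \<and> (\<forall>i\<le>l. primeideal (Q i) R) \<and> (\<forall>i<l. Q i \<subset> Q (Suc i)))" for l
    by (rule iffI; elim exE conjE; (rule up | rule down); assumption)
  show ?thesis
    unfolding krull_dim_def eq ..
qed

section \<open>Polynomial rings and their ideals\<close>

lemma polynomial_ring_simps [simp]:
  "monoid.mult (polynomial_ring V) = (*)"
  "one (polynomial_ring V) = 1"
  "zero (polynomial_ring V) = 0"
  "add (polynomial_ring V) = (+)"
  by (simp_all add: polynomial_ring_def)

lemma in_polynomial_ring_iff:
  "p \<in> carrier (polynomial_ring V) \<longleftrightarrow> (\<forall>m \<in> Poly_Mapping.keys p. Poly_Mapping.keys m \<subseteq> V)"
  by (simp add: polynomial_ring_def)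

lemma keys_add_nat: "Poly_Mapping.keys (a + b) = Poly_Mapping.keys a \<union> Poly_Mapping.keys (b :: 'v \<Rightarrow>\<^sub>0 nat)"
  by (auto simp: in_keys_iff lookup_add)

lemma keys_uminus: "Poly_Mapping.keys (- p) = Poly_Mapping.keys (p :: 'a \<Rightarrow>\<^sub>0 'b::ab_group_add)"
  by (auto simp: in_keys_iff)

lemma polynomial_ring_closed:
  fixes p q :: "('v, 'k::comm_ring_1) polynomial"
  assumes "p \<in> carrier (polynomial_ring V)" "q \<in> carrier (polynomial_ring V)"
  shows "p + q \<in> carrier (polynomial_ring V)" "p * q \<in> carrier (polynomial_ring V)"
    "- p \<in> carrier (polynomial_ring V)"
proof -
  show "p + q \<in> carrier (polynomial_ring V)"
    using assms keys_add[of p q] by (auto simp: in_polynomial_ring_iff)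
  show "p * q \<in> carrier (polynomial_ring V)"
    unfolding in_polynomial_ring_iff
  proof
    fix m assume "m \<in> Poly_Mapping.keys (p * q)"
    then obtain a b where "m = a + b" "a \<in> Poly_Mapping.keys p" "b \<in> Poly_Mapping.keys q"
      using keys_mult[of p q] by blast
    then show "Poly_Mapping.keys m \<subseteq> V"
      using assms by (simp add: in_polynomial_ring_iff keys_add_nat)
  qed
  show "- p \<in> carrier (polynomial_ring V)"
    using assms by (simp add: in_polynomial_ring_iff keys_uminus)
qed

lemma single_in_polynomial_ring:
  "Poly_Mapping.keys m \<subseteq> V \<Longrightarrow> Poly_Mapping.single m c \<in> carrier (polynomial_ring V)"
  by (simp add: in_polynomial_ring_iff)

lemma polynomial_ring_1: "1 \<in> carrier (polynomial_ring V)"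
  by (simp add: in_polynomial_ring_iff)

lemma polynomial_ring_0: "0 \<in> carrier (polynomial_ring V)"
  by (simp add: in_polynomial_ring_iff)

lemma polynomial_ring_sum:
  "(\<And>x. x \<in> X \<Longrightarrow> f x \<in> carrier (polynomial_ring V)) \<Longrightarrow> sum f X \<in> carrier (polynomial_ring V)"
  by (induction X rule: infinite_finite_induct)
    (auto simp: polynomial_ring_0 polynomial_ring_closed)

lemma polynomial_ring_power:
  "p \<in> carrier (polynomial_ring V) \<Longrightarrow> p ^ n \<in> carrier (polynomial_ring V)"
  by (induction n) (auto simp: polynomial_ring_1 polynomial_ring_closed)

lemma cring_polynomial_ring: "cring (polynomial_ring V :: ('v, 'k::comm_ring_1) polynomial ring)"
proof (rule cringI)
  show "abelian_group (polynomial_ring V :: ('v, 'k) polynomial ring)"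
  proof (rule abelian_groupI, goal_cases)
    case (6 p)
    then show ?case by (intro bexI[of _ "- p"]) (auto simp: polynomial_ring_closed)
  qed (auto simp: polynomial_ring_closed polynomial_ring_0)
  show "comm_monoid (polynomial_ring V :: ('v, 'k) polynomial ring)"
    by (rule comm_monoidI) (auto simp: polynomial_ring_closed polynomial_ring_1)
qed (simp add: algebra_simps)

lemma poly_mapping_eq_sum_single:
  "p = (\<Sum>m\<in>Poly_Mapping.keys p. Poly_Mapping.single m (Poly_Mapping.lookup p m))"
  by (rule poly_mapping_eqI) (auto simp: lookup_sum lookup_single when_def in_keys_iff)

lemma ideal_polynomial_ring:
  assumes "ideal Q (polynomial_ring V)"
  shows ideal_polynomial_ring_zero: "0 \<in> Q"
    and ideal_polynomial_ring_add: "p \<in> Q \<Longrightarrow> q \<in> Q \<Longrightarrow> p + q \<in> Q"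
    and ideal_polynomial_ring_mult: "p \<in> Q \<Longrightarrow> r \<in> carrier (polynomial_ring V) \<Longrightarrow> r * p \<in> Q"
    and ideal_polynomial_ring_subset: "Q \<subseteq> carrier (polynomial_ring V)"
proof -
  interpret ideal Q "polynomial_ring V" by fact
  show "0 \<in> Q" using additive_subgroup.zero_closed[OF additive_subgroup_axioms] by simp
  show "p \<in> Q \<Longrightarrow> q \<in> Q \<Longrightarrow> p + q \<in> Q" using additive_subgroup.a_closed[OF additive_subgroup_axioms, of p q] by simp
  show "p \<in> Q \<Longrightarrow> r \<in> carrier (polynomial_ring V) \<Longrightarrow> r * p \<in> Q" using I_l_closed[of p r] by simp
  show "Q \<subseteq> carrier (polynomial_ring V)" by (rule a_subset)
qed

lemma ideal_polynomial_ring_diff: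
  fixes p :: "('v, 'k::comm_ring_1) polynomial"
  assumes "ideal Q (polynomial_ring V)" "p \<in> Q" "q \<in> Q"
  shows "p - q \<in> Q"
proof -
  have "- 1 * q \<in> Q"
    using ideal_polynomial_ring_mult[OF assms(1,3)] polynomial_ring_1 polynomial_ring_closed(3) by blast
  then show ?thesis
    using ideal_polynomial_ring_add[OF assms(1,2), of "- q"] by simp
qed

lemma ideal_polynomial_ring_sum:
  assumes "ideal Q (polynomial_ring V)" "\<And>x. x \<in> X \<Longrightarrow> f x \<in> Q"
  shows "sum f X \<in> Q"
  using assms(2) by (induction X rule: infinite_finite_induct)
    (auto simp: ideal_polynomial_ring_zero[OF assms(1)] ideal_polynomial_ring_add[OF assms(1)])

lemma primeideal_polynomial_ring_power:
  assumes "primeideal Q (polynomial_ring V)" "p \<in> carrier (polynomial_ring V)" "p \<notin> Q"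
  shows "p ^ n \<notin> Q"
proof (induction n)
  case 0
  interpret primeideal Q "polynomial_ring V" by fact
  show ?case using ideal.one_imp_carrier[OF ideal_axioms] I_notcarr by auto
next
  case (Suc n)
  interpret primeideal Q "polynomial_ring V" by fact
  show ?case using I_prime[of p "p ^ n"] Suc assms by (auto simp: polynomial_ring_power)
qed

text \<open>
  This is the ideal generated by the variables in \<open>V - A\<close>, or the kernel of the map that sets these
  variables to \<open>0\<close>; in this form, membership can be read off the monomials.
\<close>

definition coordinate_ideal :: "'v set \<Rightarrow> 'v set \<Rightarrow> ('v, 'k::comm_ring_1) polynomial set" where
  "coordinate_ideal V A =
     {p \<in> carrier (polynomial_ring V). \<forall>m \<in> Poly_Mapping.keys p. \<not> Poly_Mapping.keys m \<subseteq> A}"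

lemma ideal_coordinate_ideal:
  "ideal (coordinate_ideal V A :: ('v, 'k::comm_ring_1) polynomial set) (polynomial_ring V)"
proof -
  interpret R: cring "polynomial_ring V :: ('v, 'k) polynomial ring"
    by (rule cring_polynomial_ring)
  have add: "p + q \<in> coordinate_ideal V A"
    if "p \<in> coordinate_ideal V A" "q \<in> coordinate_ideal V A" for p q :: "('v, 'k) polynomial"
    using that keys_add[of p q] unfolding coordinate_ideal_def by (auto intro: polynomial_ring_closed)
  have mult: "r * p \<in> coordinate_ideal V A"
    if "p \<in> coordinate_ideal V A" "r \<in> carrier (polynomial_ring V)" for p r :: "('v, 'k) polynomial"
  proof -
    have "\<not> Poly_Mapping.keys m \<subseteq> A" if "m \<in> Poly_Mapping.keys (r * p)" for m
    proof -
      obtain a b where "m = a + b" "b \<in> Poly_Mapping.keys p"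
        using \<open>m \<in> _\<close> keys_mult[of r p] by blast
      then show ?thesis
        using \<open>p \<in> _\<close> by (auto simp: coordinate_ideal_def keys_add_nat)
    qed
    then show ?thesis
      using that by (simp add: coordinate_ideal_def polynomial_ring_closed)
  qed
  have "- p \<in> coordinate_ideal V A" if "p \<in> coordinate_ideal V A" for p :: "('v, 'k) polynomial"
    using that unfolding coordinate_ideal_def by (auto simp: keys_uminus polynomial_ring_closed)
  moreover have "\<ominus>\<^bsub>polynomial_ring V\<^esub> p = - p" if "p \<in> carrier (polynomial_ring V)" for p :: "('v, 'k) polynomial"
    using R.minus_equality[of "- p" p] that by (simp add: polynomial_ring_closed)
  moreover have "coordinate_ideal V A \<subseteq> (carrier (polynomial_ring V) :: ('v, 'k) polynomial set)"
    unfolding coordinate_ideal_def by auto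
  moreover have "(0 :: ('v, 'k) polynomial) \<in> coordinate_ideal V A"
    by (simp add: coordinate_ideal_def polynomial_ring_0)
  ultimately have "subgroup (coordinate_ideal V A :: ('v, 'k) polynomial set) (add_monoid (polynomial_ring V))"
    using add by (intro R.add.subgroupI) (auto simp flip: a_inv_def)
  then show ?thesis
    using mult by (intro idealI) (auto simp: R.ring_axioms mult.commute)
qed

text \<open>
  Modulo the ideal generated by the other variables, only the monomials in the variables of \<open>A\<close>
  matter: the ring decomposes as a direct sum of the coordinate ideal and the polynomial ring on \<open>A\<close>.
\<close>

lemma split_off_variables:
  fixes p :: "('v, 'k::comm_ring_1) polynomial"
  assumes "p \<in> carrier (polynomial_ring V)" "A \<subseteq> V"
  obtains q where "q \<in> carrier (polynomial_ring A)" "p - q \<in> coordinate_ideal V A"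
proof -
  let ?s = "\<lambda>m. Poly_Mapping.single m (Poly_Mapping.lookup p m)"
  let ?K = "{m \<in> Poly_Mapping.keys p. Poly_Mapping.keys m \<subseteq> A}"
  have "(\<Sum>m\<in>?K. ?s m) \<in> carrier (polynomial_ring A)"
    by (auto intro!: polynomial_ring_sum single_in_polynomial_ring)
  moreover have "p - (\<Sum>m\<in>?K. ?s m) = (\<Sum>m\<in>Poly_Mapping.keys p - ?K. ?s m)"
    by (subst (1) poly_mapping_eq_sum_single) (simp add: sum_diff)
  moreover have "(\<Sum>m\<in>Poly_Mapping.keys p - ?K. ?s m) \<in> coordinate_ideal V A"
    using assms by (intro ideal_polynomial_ring_sum[OF ideal_coordinate_ideal])
      (auto simp: coordinate_ideal_def in_polynomial_ring_iff)
  ultimately show thesis using that[of "\<Sum>m\<in>?K. ?s m"] by simp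
qed

lemma coordinate_ideal_Int_polynomial_ring:
  "p \<in> coordinate_ideal V A \<Longrightarrow> p \<in> carrier (polynomial_ring A) \<Longrightarrow> p = 0"
  by (rule iffD1[OF keys_eq_empty], rule equals0I) (simp add: coordinate_ideal_def in_polynomial_ring_iff)

text \<open>
  The quotient is the polynomial ring on \<open>A\<close>, which is a domain. In terms of the direct sum
  decomposition: the parts of \<open>p\<close> and \<open>q\<close> on \<open>A\<close> multiply to an element of the ideal which only
  involves variables of \<open>A\<close>, hence to \<open>0\<close>. The order on the variables serves to exclude zero divisors,
  through leading monomials.
\<close>

lemma primeideal_coordinate_ideal:
  assumes "A \<subseteq> V"
  shows "primeideal (coordinate_ideal V A :: ('v::linorder, 'k::idom) polynomial set) (polynomial_ring V)"
proof (rule primeidealI[OF ideal_coordinate_ideal cring_polynomial_ring])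
  have "(1 :: ('v, 'k) polynomial) \<notin> coordinate_ideal V A"
    by (simp add: coordinate_ideal_def)
  then show "carrier (polynomial_ring V) \<noteq> (coordinate_ideal V A :: ('v, 'k) polynomial set)"
    using polynomial_ring_1 by metis
next
  fix p q :: "('v, 'k) polynomial"
  assume pq: "p \<in> carrier (polynomial_ring V)" "q \<in> carrier (polynomial_ring V)"
    and "p \<otimes>\<^bsub>polynomial_ring V\<^esub> q \<in> coordinate_ideal V A"
  then have prod: "p * q \<in> coordinate_ideal V A" by simp
  obtain p' where p': "p' \<in> carrier (polynomial_ring A)" "p - p' \<in> coordinate_ideal V A"
    using split_off_variables[OF pq(1) assms] .
  obtain q' where q': "q' \<in> carrier (polynomial_ring A)" "q - q' \<in> coordinate_ideal V A"
    using split_off_variables[OF pq(2) assms] .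
  note ideal = ideal_coordinate_ideal[of V A, where ?'k = 'k]
  have "q' \<in> carrier (polynomial_ring V)"
    using q'(1) assms by (fastforce simp: in_polynomial_ring_iff)
  then have "p * (q - q') + q' * (p - p') \<in> coordinate_ideal V A"
    using p' q' pq by (intro ideal_polynomial_ring_add[OF ideal] ideal_polynomial_ring_mult[OF ideal])
  then have "p * q - (p * (q - q') + q' * (p - p')) \<in> coordinate_ideal V A"
    by (rule ideal_polynomial_ring_diff[OF ideal prod])
  also have "p * q - (p * (q - q') + q' * (p - p')) = p' * q'"
    by (simp add: algebra_simps)
  finally have "p' * q' = 0"
    using p' q' by (intro coordinate_ideal_Int_polynomial_ring polynomial_ring_closed)
  then show "p \<in> coordinate_ideal V A \<or> q \<in> coordinate_ideal V A"
    using p'(2) q'(2) by auto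
qed

section \<open>Algebraic dependence by counting monomials\<close>

lemma (in vector_space) linear_relation_of_large_family:
  assumes "finite T" "f ` X \<subseteq> span T" "finite X" "card T < card X"
  obtains c where "\<exists>x\<in>X. c x \<noteq> 0" "(\<Sum>x\<in>X. c x *s f x) = 0"
proof (cases "inj_on f X")
  case True
  have "dependent (f ` X)"
    using independent_span_bound[OF assms(1) _ assms(2)] card_image[OF True] assms(4) by fastforce
  then obtain u where u: "\<exists>v\<in>f ` X. u v \<noteq> 0" "(\<Sum>v\<in>f ` X. u v *s v) = 0"
    using dependent_finite[of "f ` X"] assms(3) by auto
  show ?thesis
    by (rule that[of "u \<circ> f"]) (use u in \<open>auto simp: sum.reindex[OF True]\<close>)
next
  case False
  then obtain x y where xy: "x \<in> X" "y \<in> X" "x \<noteq> y" "f x = f y"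
    by (auto simp: inj_on_def)
  \<comment> \<open>A repeated vector gives the relation \<open>f x - f y = 0\<close>.\<close>
  define c :: "_ \<Rightarrow> 'a" where "c = (\<lambda>z. if z = x then 1 else if z = y then - 1 else 0)"
  have "(\<Sum>z\<in>X. c z *s f z) = (\<Sum>z\<in>{x, y}. c z *s f z)"
    by (rule sum.mono_neutral_right) (use assms(3) xy in \<open>auto simp: c_def\<close>)
  also have "\<dots> = 0"
    using xy by (simp add: c_def)
  finally show ?thesis
    using xy(1) by (intro that[of c]) (auto simp: c_def)
qed

lemma vector_space_polynomials:
  "vector_space (\<lambda>c (p :: ('v, 'k::field) polynomial). Poly_Mapping.single 0 c * p)"
  by unfold_locales
    (simp_all add: algebra_simps single_add mult_single flip: mult.assoc)

lemma card_monomials_of_bounded_degree: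
  fixes J :: "'v set" and B :: nat
  assumes "finite J"
  defines "M \<equiv> {m. Poly_Mapping.keys m \<subseteq> J \<and> (\<forall>v. Poly_Mapping.lookup m v \<le> B)}"
  shows "finite M" "card M \<le> (B + 1) ^ card J"
proof -
  let ?f = "\<lambda>m :: 'v \<Rightarrow>\<^sub>0 nat. restrict (Poly_Mapping.lookup m) J"
  have "inj_on ?f M"
  proof (rule inj_onI, rule poly_mapping_eqI)
    fix m m' v assume m: "m \<in> M" "m' \<in> M" "?f m = ?f m'"
    show "Poly_Mapping.lookup m v = Poly_Mapping.lookup m' v"
    proof (cases "v \<in> J")
      case True
      then show ?thesis using fun_cong[OF m(3), of v] by simp
    next
      case False
      then have "v \<notin> Poly_Mapping.keys m" "v \<notin> Poly_Mapping.keys m'"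
        using m by (auto simp: M_def)
      then show ?thesis by (simp add: in_keys_iff)
    qed
  qed
  moreover have "?f ` M \<subseteq> (J \<rightarrow>\<^sub>E {..B})"
    by (auto simp: M_def)
  moreover have "finite (J \<rightarrow>\<^sub>E {..B})"
    using assms by (simp add: finite_PiE)
  moreover have "card (J \<rightarrow>\<^sub>E {..B}) = (B + 1) ^ card J"
    using assms by (simp add: card_PiE)
  ultimately show "finite M" "card M \<le> (B + 1) ^ card J"
    by (metis inj_on_finite, metis card_inj_on_le)
qed

text \<open>
  This bounds the degree in each variable separately, so that the monomials allowed form a
  box, which is easy to count.
\<close>

definition exponents_le :: "nat \<Rightarrow> ('v, 'k::comm_ring_1) polynomial \<Rightarrow> bool" where
  "exponents_le B p \<longleftrightarrow> (\<forall>m \<in> Poly_Mapping.keys p. \<forall>v. Poly_Mapping.lookup m v \<le> B)"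

lemma exponents_le_mono: "exponents_le B p \<Longrightarrow> B \<le> B' \<Longrightarrow> exponents_le B' p"
  by (meson exponents_le_def order_trans)

lemma exponents_le_exists: "\<exists>B. exponents_le B p"
proof
  let ?X = "\<Union>m\<in>Poly_Mapping.keys p. Poly_Mapping.lookup m ` Poly_Mapping.keys m"
  show "exponents_le (Max (insert 0 ?X)) p"
    unfolding exponents_le_def
  proof (intro ballI allI)
    fix m v assume m: "m \<in> Poly_Mapping.keys p"
    have "Poly_Mapping.lookup m v \<in> insert 0 ?X"
      using m by (cases "v \<in> Poly_Mapping.keys m") (blast, simp add: in_keys_iff)
    then show "Poly_Mapping.lookup m v \<le> Max (insert 0 ?X)"
      by (intro Max_ge) auto
  qed
qed

lemma exponents_le_mult:
  assumes "exponents_le B p" "exponents_le B' q"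
  shows "exponents_le (B + B') (p * q)"
  unfolding exponents_le_def
proof (intro ballI allI)
  fix m v assume "m \<in> Poly_Mapping.keys (p * q)"
  then obtain a b where "m = a + b" "a \<in> Poly_Mapping.keys p" "b \<in> Poly_Mapping.keys q"
    using keys_mult[of p q] by blast
  then show "Poly_Mapping.lookup m v \<le> B + B'"
    using assms by (simp add: exponents_le_def lookup_add add_mono)
qed

lemma exponents_le_1: "exponents_le 0 1"
  by (simp add: exponents_le_def)

lemma exponents_le_power: "exponents_le B p \<Longrightarrow> exponents_le (n * B) (p ^ n)"
  by (induction n) (auto simp: exponents_le_1 exponents_le_mult)

definition power_product :: "'a::comm_monoid_mult list \<Rightarrow> nat list \<Rightarrow> 'a" where
  "power_product ys e = prod_list (map2 (^) ys e)"

lemma power_product_simps [simp]: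
  "power_product [] e = 1"
  "power_product (y # ys) (n # e) = y ^ n * power_product ys e"
  by (simp_all add: power_product_def)

lemma power_product_in_polynomial_ring:
  assumes "length e = length ys" "set ys \<subseteq> carrier (polynomial_ring V)"
  shows "power_product ys e \<in> carrier (polynomial_ring V)"
  using assms by (induction e ys rule: list_induct2)
    (auto simp: polynomial_ring_1 polynomial_ring_closed polynomial_ring_power)

lemma exponents_le_power_product:
  assumes "length e = length ys" "\<And>y. y \<in> set ys \<Longrightarrow> exponents_le D y" "set e \<subseteq> {..N}"
  shows "exponents_le (length ys * (N * D)) (power_product ys e)"
  using assms
proof (induction e ys rule: list_induct2)
  case Nil
  then show ?case by (simp add: exponents_le_1)
next
  case (Cons n e y ys)
  have "exponents_le (N * D) (y ^ n)"
    using Cons.prems by (auto intro!: exponents_le_mono[OF exponents_le_power[of D]] mult_le_mono1)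
  then show ?case
    using exponents_le_mult Cons by fastforce
qed

text \<open>
  The growth comparison behind algebraic dependence. The left side bounds the number of monomials in \<open>d\<close> variables
  which occur in power products of \<open>r\<close> polynomials with exponents at most \<open>N\<close>, the right side counts
  these power products. As functions of \<open>N\<close> they have degrees \<open>d\<close> and \<open>r\<close>, so for \<open>d < r\<close> the right
  side wins for large \<open>N\<close>. How large can be read off from \<open>r N D + 1 \<le> (r D + 1) (N + 1)\<close>: after
  cancellation of \<open>(N + 1)\<^sup>d\<close> it suffices that \<open>N + 1\<close> exceeds \<open>(r D + 1)\<^sup>d\<close>.
\<close>

lemma exponents_outnumber_monomials:
  fixes d r D :: nat
  assumes "d < r"
  defines "N \<equiv> (r * D + 1) ^ d"
  shows "(r * (N * D) + 1) ^ d < (N + 1) ^ r"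
proof -
  have "r * (N * D) + 1 \<le> (r * D + 1) * (N + 1)"
    by (simp add: algebra_simps)
  then have "(r * (N * D) + 1) ^ d \<le> (r * D + 1) ^ d * (N + 1) ^ d"
    by (metis power_mono power_mult_distrib zero_le)
  also have "\<dots> < (N + 1) * (N + 1) ^ d"
    by (simp add: N_def)
  also have "\<dots> \<le> (N + 1) ^ r"
    using assms(1) by (metis Suc_leI le_add2 power_Suc power_increasing)
  finally show ?thesis .
qed

text \<open>
  More polynomials than variables are algebraically dependent: their power products with exponents at
  most \<open>N\<close> lie in a space spanned by fewer monomials, hence are linearly dependent.
  The relation is recorded by its set \<open>E\<close> of exponent lists and their nonzero
  coefficients \<open>c\<close>.
\<close>

lemma algebraic_dependence:
  fixes ys :: "('v, 'k::field) polynomial list"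
  assumes "finite J" "set ys \<subseteq> carrier (polynomial_ring J)" "card J < length ys"
  obtains E c where "finite E" "E \<noteq> {}" "\<And>e. e \<in> E \<Longrightarrow> length e = length ys" "\<And>e. e \<in> E \<Longrightarrow> c e \<noteq> 0"
    "(\<Sum>e\<in>E. Poly_Mapping.single 0 (c e) * power_product ys e) = 0"
proof -
  interpret vector_space "\<lambda>c (p :: ('v, 'k) polynomial). Poly_Mapping.single 0 c * p"
    by (rule vector_space_polynomials)
  obtain D where D: "\<And>y. y \<in> set ys \<Longrightarrow> exponents_le D y"
  proof -
    obtain b where "exponents_le (b y) y" for y :: "('v, 'k) polynomial"
      using exponents_le_exists by metis
    then show thesis
      by (intro that[of "Max (b ` set ys)"] exponents_le_mono[OF _ Max_ge]) auto
  qed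
  define N where "N = (length ys * D + 1) ^ card J"
  define B where "B = length ys * (N * D)"
  define M where "M = {m :: 'v \<Rightarrow>\<^sub>0 nat. Poly_Mapping.keys m \<subseteq> J \<and> (\<forall>v. Poly_Mapping.lookup m v \<le> B)}"
  define T where "T = (\<lambda>m. Poly_Mapping.single m (1 :: 'k)) ` M"
  define X where "X = {e. set e \<subseteq> {..N} \<and> length e = length ys}"
  have M: "finite M" "card M \<le> (B + 1) ^ card J"
    unfolding M_def by (rule card_monomials_of_bounded_degree[OF assms(1)])+
  have "card T \<le> (B + 1) ^ card J"
    unfolding T_def using card_image_le[OF M(1)] M(2) by (rule order_trans)
  also have "\<dots> < (N + 1) ^ length ys"
    unfolding B_def N_def using assms(3) by (rule exponents_outnumber_monomials)
  also have "\<dots> = card X"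
    by (simp add: X_def card_lists_length_eq)
  finally have card: "card T < card X" .
  have "power_product ys e \<in> span T" if e: "e \<in> X" for e
  proof -
    let ?p = "power_product ys e"
    have "?p \<in> carrier (polynomial_ring J)" "exponents_le B ?p"
      using e D assms(2) unfolding X_def B_def
      by (auto intro!: power_product_in_polynomial_ring exponents_le_power_product)
    then have "Poly_Mapping.keys ?p \<subseteq> M"
      by (auto simp: M_def in_polynomial_ring_iff exponents_le_def)
    then have "(\<Sum>m\<in>Poly_Mapping.keys ?p. Poly_Mapping.single 0 (Poly_Mapping.lookup ?p m) * Poly_Mapping.single m 1) \<in> span T"
      by (intro span_sum span_scale span_base) (auto simp: T_def)
    also have "(\<Sum>m\<in>Poly_Mapping.keys ?p. Poly_Mapping.single 0 (Poly_Mapping.lookup ?p m) * Poly_Mapping.single m 1) = ?p"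
      using poly_mapping_eq_sum_single[of ?p] by (simp add: mult_single)
    finally show ?thesis .
  qed
  then have "power_product ys ` X \<subseteq> span T" by blast
  moreover have "finite T" "finite X"
    using M(1) by (auto simp: T_def X_def intro: finite_lists_length_eq)
  ultimately obtain c where c: "\<exists>e\<in>X. c e \<noteq> 0"
      "(\<Sum>e\<in>X. Poly_Mapping.single 0 (c e) * power_product ys e) = 0"
    using linear_relation_of_large_family card by blast
  show thesis
  proof (rule that[of "{e \<in> X. c e \<noteq> 0}" c])
    have "(\<Sum>e\<in>{e \<in> X. c e \<noteq> 0}. Poly_Mapping.single 0 (c e) * power_product ys e) =
        (\<Sum>e\<in>X. Poly_Mapping.single 0 (c e) * power_product ys e)"
      using \<open>finite X\<close> by (intro sum.mono_neutral_left) auto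
    then show "(\<Sum>e\<in>{e \<in> X. c e \<noteq> 0}. Poly_Mapping.single 0 (c e) * power_product ys e) = 0"
      using c(2) by simp
    show "finite {e \<in> X. c e \<noteq> 0}"
      using \<open>finite X\<close> by simp
  qed (use c(1) in \<open>auto simp: X_def\<close>)
qed

section \<open>Chains of prime ideals\<close>

text \<open>
  The elements \<open>y\<^sub>i \<in> Q\<^bsub>i+1\<^esub> - Q\<^sub>i\<close> witness that the chain is strict. Suppose that a nonzero
  polynomial expression in \<open>y\<^sub>0, y\<^sub>1, \<dots>\<close> lies in \<open>Q\<^sub>0\<close>. After division by the greatest possible power
  of \<open>y\<^sub>0\<close>, which is allowed as \<open>Q\<^sub>0\<close> is prime and does not contain \<open>y\<^sub>0\<close>, it has the form \<open>A + y\<^sub>0 B\<close> with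
  a nonzero expression \<open>A\<close> in \<open>y\<^sub>1, y\<^sub>2, \<dots>\<close> only. Both \<open>A + y\<^sub>0 B\<close> and \<open>y\<^sub>0\<close> lie in \<open>Q\<^sub>1\<close>, so \<open>A\<close> does,
  too, and the argument can be repeated along the rest of the chain. In the end, a nonzero constant lies in the last
  prime, which is absurd. The constant is the coefficient of the lexicographically least monomial.
\<close>

lemma no_algebraic_relation_along_chain:
  fixes ys :: "('v, 'k::field) polynomial list" and Q :: "nat \<Rightarrow> ('v, 'k) polynomial set"
  assumes "\<And>i. i \<le> length ys \<Longrightarrow> primeideal (Q i) (polynomial_ring V)"
    and "\<And>i. i < length ys \<Longrightarrow> Q i \<subseteq> Q (Suc i) \<and> ys ! i \<in> Q (Suc i) \<and> ys ! i \<notin> Q i"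
    and "finite E" "E \<noteq> {}" "\<And>e. e \<in> E \<Longrightarrow> length e = length ys" "\<And>e. e \<in> E \<Longrightarrow> c e \<noteq> 0"
  shows "(\<Sum>e\<in>E. Poly_Mapping.single 0 (c e) * power_product ys e) \<notin> Q 0"
  using assms
proof (induction ys arbitrary: Q E c)
  case Nil
  interpret Q: primeideal "Q 0" "polynomial_ring V" using Nil.prems(1) by simp
  have "E = {[]}" using Nil.prems(4,5) by auto
  moreover have "Poly_Mapping.single 0 (c []) \<notin> Q 0"
  proof
    assume "Poly_Mapping.single 0 (c []) \<in> Q 0"
    then have "Poly_Mapping.single 0 (inverse (c [])) * Poly_Mapping.single 0 (c []) \<in> Q 0"
      by (intro ideal_polynomial_ring_mult[OF Q.is_ideal] single_in_polynomial_ring) auto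
    then have "1 \<in> Q 0"
      using Nil.prems(6)[of "[]"] \<open>E = {[]}\<close> by (simp add: mult_single)
    then show False
      using ideal.one_imp_carrier[OF Q.is_ideal] Q.I_notcarr by simp
  qed
  ultimately show ?case by simp
next
  case (Cons y ys)
  interpret Q0: primeideal "Q 0" "polynomial_ring V" using Cons.prems(1) by simp
  interpret Q1: primeideal "Q 1" "polynomial_ring V" using Cons.prems(1) by simp
  have carr: "z \<in> carrier (polynomial_ring V)" if z: "z \<in> set (y # ys)" for z
  proof -
    obtain i where i: "i < length (y # ys)" "(y # ys) ! i = z"
      using z unfolding in_set_conv_nth by blast
    interpret Qi: primeideal "Q (Suc i)" "polynomial_ring V" using Cons.prems(1) i by simp
    show ?thesis
      using Cons.prems(2)[OF i(1)] i(2) ideal_polynomial_ring_subset[OF Qi.is_ideal] by auto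
  qed
  have y: "y \<in> Q 1" "y \<notin> Q 0" "Q 0 \<subseteq> Q 1"
    using Cons.prems(2)[of 0] by auto
  \<comment> \<open>\<open>y ^ n\<close> is the greatest power of \<open>y\<close> that divides every term.\<close>
  define n where "n = Min (hd ` E)"
  define E0 where "E0 = {e \<in> E. hd e = n}"
  define E1 where "E1 = {e \<in> E. hd e \<noteq> n}"
  have n_le: "n \<le> hd e" if "e \<in> E" for e
    using that Cons.prems(3) by (simp add: n_def)
  have "n \<in> hd ` E"
    unfolding n_def using Cons.prems(3,4) by (intro Min_in) auto
  then have "E0 \<noteq> {}" by (auto simp: E0_def)
  have len: "e = hd e # tl e" "length (tl e) = length ys" if "e \<in> E" for e
    using Cons.prems(5)[OF that] by (cases e; simp)+
  let ?t = "\<lambda>e. Poly_Mapping.single 0 (c e) * power_product ys (tl e)"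
  define A where "A = (\<Sum>e\<in>E0. ?t e)"
  define B where "B = (\<Sum>e\<in>E1. y ^ (hd e - n - 1) * ?t e)"
  have t_carr: "?t e \<in> carrier (polynomial_ring V)" if "e \<in> E" for e
    using that len(2) carr
    by (intro polynomial_ring_closed single_in_polynomial_ring power_product_in_polynomial_ring) auto
  have AB_carr: "A \<in> carrier (polynomial_ring V)" "B \<in> carrier (polynomial_ring V)"
    unfolding A_def B_def using t_carr carr
    by (auto intro!: polynomial_ring_sum polynomial_ring_closed(2)[OF polynomial_ring_power] simp: E0_def E1_def)
  have term0: "Poly_Mapping.single 0 (c e) * power_product (y # ys) e = y ^ n * ?t e" if "e \<in> E0" for e
  proof -
    have "power_product (y # ys) e = y ^ n * power_product ys (tl e)"
      using that len(1)[of e] power_product_simps(2)[of y ys "hd e" "tl e"] by (simp add: E0_def)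
    then show ?thesis by (simp add: algebra_simps)
  qed
  have term1: "Poly_Mapping.single 0 (c e) * power_product (y # ys) e =
      y ^ n * (y * (y ^ (hd e - n - 1) * ?t e))" if "e \<in> E1" for e
  proof -
    have "n + Suc (hd e - n - 1) = hd e"
      using that n_le[of e] by (simp add: E1_def)
    moreover have "y ^ (n + Suc (hd e - n - 1)) = y ^ n * (y * y ^ (hd e - n - 1))"
      by (simp add: power_add)
    ultimately have "y ^ hd e = y ^ n * (y * y ^ (hd e - n - 1))"
      by simp
    moreover have "power_product (y # ys) e = y ^ hd e * power_product ys (tl e)"
      using that len(1)[of e] power_product_simps(2)[of y ys "hd e" "tl e"] by (simp add: E1_def)
    ultimately show ?thesis by (simp add: algebra_simps)
  qed
  have "E = E0 \<union> E1" "E0 \<inter> E1 = {}" "finite E0" "finite E1"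
    using Cons.prems(3) by (auto simp: E0_def E1_def)
  then have "(\<Sum>e\<in>E. Poly_Mapping.single 0 (c e) * power_product (y # ys) e) =
      (\<Sum>e\<in>E0. Poly_Mapping.single 0 (c e) * power_product (y # ys) e) +
      (\<Sum>e\<in>E1. Poly_Mapping.single 0 (c e) * power_product (y # ys) e)"
    by (simp add: sum.union_disjoint)
  also have "\<dots> = y ^ n * (A + y * B)"
    by (simp add: A_def B_def term0 term1 sum_distrib_left distrib_left)
  finally have sum_eq: "(\<Sum>e\<in>E. Poly_Mapping.single 0 (c e) * power_product (y # ys) e) = y ^ n * (A + y * B)" .
  have A_eq: "A = (\<Sum>e\<in>tl ` E0. Poly_Mapping.single 0 (c (n # e)) * power_product ys e)"
  proof -
    have E0: "e = n # tl e" if "e \<in> E0" for e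
      using that len(1)[of e] by (simp add: E0_def)
    have "inj_on tl E0"
      using E0 by (intro inj_on_inverseI[where g = "(#) n"]) simp
    then have "(\<Sum>e\<in>tl ` E0. Poly_Mapping.single 0 (c (n # e)) * power_product ys e) =
        (\<Sum>e\<in>E0. Poly_Mapping.single 0 (c (n # tl e)) * power_product ys (tl e))"
      by (simp add: sum.reindex)
    also have "\<dots> = A"
      unfolding A_def using E0 by (intro sum.cong) auto
    finally show ?thesis by simp
  qed
  have "A \<notin> Q 1"
    unfolding A_eq One_nat_def
  proof (rule Cons.IH[of "\<lambda>i. Q (Suc i)"])
    show "tl ` E0 \<noteq> {}" "finite (tl ` E0)"
      using \<open>E0 \<noteq> {}\<close> Cons.prems(3) by (auto simp: E0_def)
    show "length e = length ys" if "e \<in> tl ` E0" for e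
      using that len(2) by (auto simp: E0_def)
    show "c (n # e) \<noteq> 0" if e: "e \<in> tl ` E0" for e
    proof -
      have "n # e \<in> E" using e len(1) by (auto simp: E0_def)
      then show ?thesis by (rule Cons.prems(6))
    qed
  qed (use Cons.prems(1,2) in force)+
  show ?case
  proof
    assume "(\<Sum>e\<in>E. Poly_Mapping.single 0 (c e) * power_product (y # ys) e) \<in> Q 0"
    then have "y ^ n * (A + y * B) \<in> Q 0" by (simp add: sum_eq)
    moreover have "y ^ n \<notin> Q 0"
      using primeideal_polynomial_ring_power[OF Q0.primeideal_axioms] carr y by auto
    ultimately have "A + y * B \<in> Q 1"
      using Q0.I_prime[of "y ^ n" "A + y * B"] AB_carr carr y(3)
      by (auto simp: polynomial_ring_closed polynomial_ring_power)
    moreover have "B * y \<in> Q 1"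
      by (rule ideal_polynomial_ring_mult[OF Q1.is_ideal y(1) AB_carr(2)])
    ultimately have "A \<in> Q 1"
      using ideal_polynomial_ring_diff[OF Q1.is_ideal, of "A + y * B" "B * y"] by (simp add: mult.commute)
    with \<open>A \<notin> Q 1\<close> show False by contradiction
  qed
qed

section \<open>The dimension of an edge ideal\<close>

lemma keys_Var_mult: "Poly_Mapping.keys (Var u * Var v :: ('v, 'k::comm_ring_1) polynomial) =
    {Poly_Mapping.single u 1 + Poly_Mapping.single v 1}"
  by (simp add: Var_def mult_single)

lemma Var_in_polynomial_ring: "v \<in> V \<Longrightarrow> Var v \<in> carrier (polynomial_ring V)"
  by (simp add: Var_def single_in_polynomial_ring)

lemma Var_in_coordinate_ideal_iff:
  "v \<in> V \<Longrightarrow> (Var v :: ('v, 'k::comm_ring_1) polynomial) \<in> coordinate_ideal V A \<longleftrightarrow> v \<notin> A"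
  by (simp add: coordinate_ideal_def Var_in_polynomial_ring) (simp add: Var_def)

lemma Var_mult_in_coordinate_ideal_iff:
  assumes "u \<in> V" "v \<in> V"
  shows "(Var u * Var v :: ('v, 'k::comm_ring_1) polynomial) \<in> coordinate_ideal V A \<longleftrightarrow> \<not> {u, v} \<subseteq> A"
  using assms by (simp add: coordinate_ideal_def keys_Var_mult keys_add_nat polynomial_ring_closed Var_in_polynomial_ring) blast

lemma coordinate_ideal_antimono: "A \<subseteq> B \<Longrightarrow> coordinate_ideal V B \<subseteq> coordinate_ideal V A"
  unfolding coordinate_ideal_def by blast

text \<open>
  Each monomial of an element of the coordinate ideal is a multiple of a variable outside \<open>A\<close>.
\<close>

lemma coordinate_ideal_least:
  fixes Q :: "('v, 'k::comm_ring_1) polynomial set"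
  assumes Q: "ideal Q (polynomial_ring V)" "\<And>v. v \<in> V - A \<Longrightarrow> Var v \<in> Q"
  shows "coordinate_ideal V A \<subseteq> Q"
proof
  fix p :: "('v, 'k) polynomial" assume p: "p \<in> coordinate_ideal V A"
  have "Poly_Mapping.single m (Poly_Mapping.lookup p m) \<in> Q" if m: "m \<in> Poly_Mapping.keys p" for m
  proof -
    have mV: "Poly_Mapping.keys m \<subseteq> V" and "\<not> Poly_Mapping.keys m \<subseteq> A"
      using p m by (auto simp: coordinate_ideal_def in_polynomial_ring_iff)
    then obtain v where v: "v \<in> Poly_Mapping.keys m" "v \<in> V - A" by blast
    define m' where "m' = m - Poly_Mapping.single v 1"
    have m_eq: "m = m' + Poly_Mapping.single v 1"
      using v(1) by (intro poly_mapping_eqI)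
        (auto simp: m'_def lookup_add lookup_minus lookup_single when_def in_keys_iff)
    then have "Poly_Mapping.keys m' \<subseteq> V"
      using mV keys_add_nat[of m' "Poly_Mapping.single v 1"] by simp
    then have "Poly_Mapping.single m' (Poly_Mapping.lookup p m) * Var v \<in> Q"
      using v(2) by (intro ideal_polynomial_ring_mult[OF Q(1)] Q(2) single_in_polynomial_ring)
    then show ?thesis
      using m_eq by (simp add: Var_def mult_single)
  qed
  then have "(\<Sum>m\<in>Poly_Mapping.keys p. Poly_Mapping.single m (Poly_Mapping.lookup p m)) \<in> Q"
    by (rule ideal_polynomial_ring_sum[OF Q(1)])
  then show "p \<in> Q"
    using poly_mapping_eq_sum_single[of p] by simp
qed

text \<open>
  Modulo \<open>Q 0\<close> only the variables in \<open>J\<close> survive, so the elements that separate consecutive primes of the chain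
  can be chosen as polynomials in these variables. More than \<open>card J\<close> of them would be algebraically
  dependent, which the chain forbids.
\<close>

lemma prime_chain_length_le:
  fixes Q :: "nat \<Rightarrow> ('v, 'k::field) polynomial set"
  assumes J: "finite J" "J \<subseteq> V" "coordinate_ideal V J \<subseteq> Q 0"
    and prime: "\<And>i. i \<le> l \<Longrightarrow> primeideal (Q i) (polynomial_ring V)"
    and strict: "\<And>i. i < l \<Longrightarrow> Q i \<subset> Q (Suc i)"
  shows "l \<le> card J"
proof (rule ccontr)
  assume "\<not> l \<le> card J"
  have ideal: "ideal (Q i) (polynomial_ring V)" if "i \<le> l" for i
    using prime[OF that] by (rule primeideal.axioms(1))
  have Q0: "coordinate_ideal V J \<subseteq> Q i" if "i \<le> l" for i
    using that
  proof (induction i)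
    case (Suc i)
    then show ?case using strict[of i] by auto
  qed (use J in simp)
  have "\<exists>y. y \<in> carrier (polynomial_ring J) \<and> y \<in> Q (Suc i) \<and> y \<notin> Q i" if i: "i < l" for i
  proof -
    obtain z where z: "z \<in> Q (Suc i)" "z \<notin> Q i"
      using strict[OF i] by blast
    have "z \<in> carrier (polynomial_ring V)"
      using z(1) ideal_polynomial_ring_subset[OF ideal[of "Suc i"]] i by auto
    then obtain y where y: "y \<in> carrier (polynomial_ring J)" "z - y \<in> coordinate_ideal V J"
      using split_off_variables J(2) by metis
    \<comment> \<open>\<open>z\<close> and \<open>y\<close> agree modulo every prime of the chain, so \<open>y\<close> separates them as well.\<close>
    have "z - y \<in> Q i" "z - y \<in> Q (Suc i)"
      using y(2) Q0[of i] Q0[of "Suc i"] i by auto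
    then have "y \<notin> Q i" "y \<in> Q (Suc i)"
      using ideal_polynomial_ring_add[OF ideal, of i "z - y" y]
        ideal_polynomial_ring_diff[OF ideal, of "Suc i" z "z - y"] z i by auto
    with y(1) show ?thesis by blast
  qed
  then obtain y where y: "\<And>i. i < l \<Longrightarrow> y i \<in> carrier (polynomial_ring J) \<and> y i \<in> Q (Suc i) \<and> y i \<notin> Q i"
    by metis
  define ys where "ys = map y [0..<l]"
  have "set ys \<subseteq> carrier (polynomial_ring J)" "card J < length ys"
    using y \<open>\<not> l \<le> card J\<close> by (auto simp: ys_def)
  then obtain E c where E: "finite E" "E \<noteq> {}" "\<And>e. e \<in> E \<Longrightarrow> length e = length ys" "\<And>e. e \<in> E \<Longrightarrow> c e \<noteq> 0"
    and rel: "(\<Sum>e\<in>E. Poly_Mapping.single 0 (c e) * power_product ys e) = 0"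
    using algebraic_dependence[OF J(1)] by blast
  have "(\<Sum>e\<in>E. Poly_Mapping.single 0 (c e) * power_product ys e) \<notin> Q 0"
  proof (rule no_algebraic_relation_along_chain[OF _ _ E])
    show "primeideal (Q i) (polynomial_ring V)" if "i \<le> length ys" for i
      using prime that by (simp add: ys_def)
    show "Q i \<subseteq> Q (Suc i) \<and> ys ! i \<in> Q (Suc i) \<and> ys ! i \<notin> Q i" if "i < length ys" for i
      using y[of i] strict[of i] that by (auto simp: ys_def)
  qed
  then show False
    using rel ideal_polynomial_ring_zero[OF ideal[of 0]] by simp
qed

definition independent_set :: "'v ugraph \<Rightarrow> 'v set \<Rightarrow> bool" where
  "independent_set G T \<longleftrightarrow> T \<subseteq> verts G \<and> (\<forall>u\<in>T. \<forall>v\<in>T. {u, v} \<notin> edges G)"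

text \<open>
  The dimension of the quotient by the edge ideal is the independence number of the graph. A prime
  that contains \<open>x\<^sub>u x\<^sub>v\<close> contains one of the two factors. So the variables outside the first prime of a chain form
  an independent set, whose size bounds the length of the chain. Conversely, for an independent
  set \<open>J\<close> the variables outside \<open>J\<close> generate a prime containing the edge ideal, and adding the
  variables in \<open>J\<close> one by one yields a chain of length \<open>card J\<close>.
\<close>

lemma krull_dim_edge_ideal:
  fixes G :: "'v::linorder ugraph"
  assumes G: "finite (verts G)" "\<Union> (edges G) \<subseteq> verts G"
    and J: "independent_set G J" "\<And>T. independent_set G T \<Longrightarrow> card T \<le> card J"
  shows "krull_dim (polynomial_ring (verts G) Quot (edge_ideal G :: ('v, 'k::field) polynomial set)) =
    ereal (real (card J))"
proof -
  let ?V = "verts G"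
  let ?S = "polynomial_ring ?V :: ('v, 'k) polynomial ring"
  let ?I = "edge_ideal G :: ('v, 'k) polynomial set"
  let ?L = "{ereal (real l) | l. \<exists>Q :: nat \<Rightarrow> ('v, 'k) polynomial set. ?I \<subseteq> Q 0 \<and>
            (\<forall>i\<le>l. primeideal (Q i) ?S) \<and> (\<forall>i<l. Q i \<subset> Q (Suc i))}"
  interpret S: cring ?S by (rule cring_polynomial_ring)
  have gens: "{Var u * Var v | u v. {u, v} \<in> edges G} \<subseteq> carrier ?S"
    using G(2) by (auto intro!: polynomial_ring_closed Var_in_polynomial_ring)
  have ideal_I: "ideal ?I ?S"
    unfolding edge_ideal_def by (rule S.genideal_ideal[OF gens])
  have JV: "J \<subseteq> ?V" using J(1) by (simp add: independent_set_def)
  have upper: "l \<le> card J"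
    if Q: "?I \<subseteq> Q 0" "\<forall>i\<le>l. primeideal (Q i) ?S" "\<forall>i<l. Q i \<subset> Q (Suc i)"
    for l and Q :: "nat \<Rightarrow> ('v, 'k) polynomial set"
  proof -
    interpret Q0: primeideal "Q 0" ?S using Q(2) by simp
    define T where "T = {v \<in> ?V. (Var v :: ('v, 'k) polynomial) \<notin> Q 0}"
    have "independent_set G T"
      unfolding independent_set_def
    proof (intro conjI ballI notI)
      fix u v assume uv: "u \<in> T" "v \<in> T" "{u, v} \<in> edges G"
      then have "Var u * Var v \<in> ?I"
        unfolding edge_ideal_def using S.genideal_self[OF gens] by blast
      then show False
        using Q(1) Q0.I_prime[of "Var u" "Var v"] uv(1,2) by (auto simp: T_def Var_in_polynomial_ring)
    qed (simp add: T_def)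
    then have "card T \<le> card J" by (rule J(2))
    moreover have "l \<le> card T"
    proof (rule prime_chain_length_le[of T ?V Q])
      show "coordinate_ideal ?V T \<subseteq> Q 0"
        by (rule coordinate_ideal_least[OF Q0.is_ideal]) (simp add: T_def)
      show "finite T" "T \<subseteq> ?V"
        using G(1) by (auto simp: T_def)
    qed (use Q in auto)
    ultimately show ?thesis by simp
  qed
  have lower: "ereal (real (card J)) \<in> ?L"
  proof -
    have "finite J" using JV G(1) by (rule finite_subset)
    then obtain vs where vs: "set vs = J" "distinct vs"
      using finite_distinct_list by blast
    define Q :: "nat \<Rightarrow> ('v, 'k) polynomial set" where "Q i = coordinate_ideal ?V (set (drop i vs))" for i
    have "{Var u * Var v | u v. {u, v} \<in> edges G} \<subseteq> Q 0"
    proof safe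
      fix u v assume uv: "{u, v} \<in> edges G"
      then have "u \<in> ?V" "v \<in> ?V" using G(2) by auto
      then show "Var u * Var v \<in> Q 0"
        using J(1) uv by (auto simp: Q_def vs Var_mult_in_coordinate_ideal_iff independent_set_def)
    qed
    then have "?I \<subseteq> Q 0"
      unfolding edge_ideal_def Q_def by (rule S.genideal_minimal[OF ideal_coordinate_ideal])
    moreover have "primeideal (Q i) ?S" for i
      unfolding Q_def using set_drop_subset[of i vs] vs(1) JV
      by (intro primeideal_coordinate_ideal) blast
    moreover have "Q i \<subset> Q (Suc i)" if "i < card J" for i
    proof -
      have i: "i < length vs" using that vs distinct_card[of vs] by simp
      have drop: "drop i vs = vs ! i # drop (Suc i) vs"
        using Cons_nth_drop_Suc[OF i] by simp
      have "distinct (drop i vs)" using vs(2) by simp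
      then have "vs ! i \<notin> set (drop (Suc i) vs)" by (simp add: drop)
      moreover have "vs ! i \<in> ?V" using nth_mem[OF i] vs(1) JV by blast
      ultimately have "(Var (vs ! i) :: ('v, 'k) polynomial) \<in> Q (Suc i) - Q i"
        by (simp add: Q_def Var_in_coordinate_ideal_iff drop)
      moreover have "Q i \<subseteq> Q (Suc i)"
        unfolding Q_def by (rule coordinate_ideal_antimono) (auto simp: drop)
      ultimately show ?thesis by blast
    qed
    ultimately show ?thesis by blast
  qed
  have "Sup ?L = ereal (real (card J))"
  proof (rule antisym)
    show "Sup ?L \<le> ereal (real (card J))"
      by (rule Sup_least) (use upper in force)
    show "ereal (real (card J)) \<le> Sup ?L"
      by (rule Sup_upper[OF lower])
  qed
  then show ?thesis
    by (simp only: krull_dim_quotient[OF S.is_cring ideal_I])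
qed

section \<open>Independent sets in fan graphs\<close>

lemma edge_of_clique_union_iff:
  "{u, v} \<in> edges (graph_Union (complete_graph ` \<K>)) \<longleftrightarrow> u \<noteq> v \<and> (\<exists>C\<in>\<K>. u \<in> C \<and> v \<in> C)"
  by (auto simp: graph_Union_def complete_graph_def doubleton_eq_iff)

lemma verts_clique_union: "verts (graph_Union (complete_graph ` \<K>)) = \<Union>\<K>"
  by (simp add: graph_Union_def complete_graph_def)

lemma independent_set_clique_union_iff:
  "independent_set (graph_Union (complete_graph ` \<K>)) T \<longleftrightarrow>
     T \<subseteq> \<Union>\<K> \<and> (\<forall>C\<in>\<K>. \<forall>u\<in>T \<inter> C. \<forall>v\<in>T \<inter> C. u = v)"
  unfolding independent_set_def edge_of_clique_union_iff verts_clique_union by blast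

lemma card_independent_set_le_clique_cover:
  assumes "\<And>C. C \<in> \<C> \<Longrightarrow> \<forall>u\<in>T \<inter> C. \<forall>v\<in>T \<inter> C. u = v" "T \<subseteq> \<Union>\<C>" "finite \<C>"
  shows "card T \<le> card \<C>"
proof -
  have "\<forall>v\<in>T. \<exists>C. C \<in> \<C> \<and> v \<in> C"
    using assms(2) by blast
  then obtain f where f: "\<forall>v\<in>T. f v \<in> \<C> \<and> v \<in> f v"
    by (rule bchoice[THEN exE])
  have "inj_on f T"
  proof (rule inj_onI)
    fix u v assume uv: "u \<in> T" "v \<in> T" "f u = f v"
    then have "f u \<in> \<C>" "u \<in> f u" "v \<in> f u" using f by auto
    then show "u = v" using assms(1) uv(1,2) by blast
  qed
  then show ?thesis
    using f assms(3) by (intro card_inj_on_le) auto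
qed

text \<open>
  There are \<open>card W\<close> added cliques. Each has a vertex outside \<open>{1..n}\<close>, because it has more vertices than
  it shares with the complete graph, and this vertex lies in no other clique. These new vertices form an independent set \<open>X\<close>.
  If \<open>W\<close> misses a vertex \<open>w\<close> of \<open>{1..n}\<close>, then \<open>w\<close> lies in none of the added cliques and can be joined to \<open>X\<close>.
  These sets have the maximal size, as the added cliques and \<open>{1..n}\<close> cover all vertices, and the
  added cliques alone do so for \<open>W = {1..n}\<close>: the \<open>i\<close>-th vertex of a part lies in
  its \<open>i\<close>-th clique.
\<close>

lemma fan_graph_maximum_independent_set:
  assumes G: "k_fan_graph n k W P G"
  obtains J where "independent_set G J" "\<And>T. independent_set G T \<Longrightarrow> card T \<le> card J"
    "card J = (if W = {1..n} then n else card W + 1)"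
proof -
  have W: "W \<subseteq> {1..n}" and P: "partition_on W P"
    using G by (auto simp: k_fan_graph_def)
  obtain us B where "\<forall>U\<in>P. set (us U) = U \<and> fan_branch {1..n} (us U) (B U)"
    and "\<forall>U\<in>P. \<forall>U'\<in>P. U \<noteq> U' \<longrightarrow> \<Union>(set (B U)) \<inter> \<Union>(set (B U')) \<subseteq> {1..n}"
    and G_eq: "G = graph_Union (complete_graph ` insert {1..n} (\<Union>U\<in>P. set (B U)))"
    using G unfolding k_fan_graph_def by (elim conjE exE) (rule that)
  then have fans: "\<And>U. U \<in> P \<Longrightarrow> set (us U) = U \<and> fan_branch {1..n} (us U) (B U)"
    and new: "\<And>U U'. U \<in> P \<Longrightarrow> U' \<in> P \<Longrightarrow> U \<noteq> U' \<Longrightarrow> \<Union>(set (B U)) \<inter> \<Union>(set (B U')) \<subseteq> {1..n}"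
    by simp_all
  define \<C> where "\<C> = (\<Union>U\<in>P. set (B U))"
  \<comment> \<open>\<open>(U, i) \<in> I\<close> stands for the clique \<open>B U ! i\<close>; distinct indices might give equal sets a priori.\<close>
  define I where "I = Sigma P (\<lambda>U. {..<card U})"
  have U_sub: "U \<subseteq> W" if "U \<in> P" for U
    using partition_onD1[OF P] that by blast
  have finU: "finite U" if "U \<in> P" for U
    using U_sub[OF that] W by (blast intro: finite_subset[OF _ finite_atLeastAtMost])
  have finP: "finite P"
    using finite_elements[OF finite_subset[OF W finite_atLeastAtMost] P] .
  have len: "length (us U) = card U" "length (B U) = card U" if "U \<in> P" for U
    using fans[OF that] distinct_card[of "us U"] by (auto simp: fan_branch_def)
  have card_I: "card I = card W"
  proof -
    have "card W = sum card P"
      using partition_onD1[OF P] partition_onD2[OF P] finU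
      by (simp add: card_Union_disjoint disjoint_def pairwise_def disjnt_def)
    then show ?thesis
      by (simp add: I_def finP)
  qed
  have C_eq: "\<C> = (\<lambda>(U, i). B U ! i) ` I"
    by (force simp: \<C>_def I_def set_conv_nth len)
  have "finite I" by (simp add: I_def finP)
  have base: "{1..n} \<inter> (B U ! i) = set (take (Suc i) (us U))" and big: "Suc i < card (B U ! i)"
    and finB: "finite (B U ! i)" if "(U, i) \<in> I" for U i
    using fans[of U] that len(1)[of U] by (auto simp: I_def fan_branch_def)
  have card_C: "card \<C> \<le> card W"
    unfolding C_eq card_I[symmetric] by (rule card_image_le[OF \<open>finite I\<close>])
  have "\<exists>x. x \<in> B U ! i \<and> x \<notin> {1..n}" if Ui: "(U, i) \<in> I" for U i
  proof (rule ccontr)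
    assume "\<nexists>x. x \<in> B U ! i \<and> x \<notin> {1..n}"
    then have "B U ! i = set (take (Suc i) (us U))"
      using base[OF Ui] by blast
    moreover have "card (set (take (Suc i) (us U))) \<le> Suc i"
      using card_length[of "take (Suc i) (us U)"] by simp
    ultimately show False
      using big[OF Ui] by simp
  qed
  then obtain x where x: "\<And>U i. (U, i) \<in> I \<Longrightarrow> x U i \<in> B U ! i \<and> x U i \<notin> {1..n}"
    by metis
  \<comment> \<open>Neither different fans nor different cliques of one fan share a new vertex.\<close>
  have x_unique: "(U, i) = (U', j)" if Ui: "(U, i) \<in> I" and Uj: "(U', j) \<in> I" and mem: "x U i \<in> B U' ! j" for U i U' j
  proof -
    have "B U ! i \<in> set (B U)" "B U' ! j \<in> set (B U')" and U: "U \<in> P" "U' \<in> P"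
      using Ui Uj len by (auto simp: I_def)
    then have "U = U'"
      using new[of U U'] x[OF Ui] mem by blast
    moreover have "i = j"
    proof (rule ccontr)
      assume "i \<noteq> j"
      then have "B U ! i \<inter> B U ! j \<subseteq> {1..n}"
        using fans[OF U(1)] Ui Uj len(1)[OF U(1)] \<open>U = U'\<close> by (auto simp: I_def fan_branch_def)
      then show False
        using x[OF Ui] mem \<open>U = U'\<close> by blast
    qed
    ultimately show ?thesis by simp
  qed
  define X where "X = (\<lambda>(U, i). x U i) ` I"
  have X_old: "X \<inter> {1..n} = {}"
    using x by (auto simp: X_def)
  have X_C: "X \<subseteq> \<Union>\<C>"
    using x by (auto simp: X_def C_eq)
  have X_unique: "u = x U i" if "u \<in> X" "u \<in> B U ! i" "(U, i) \<in> I" for u U i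
    using that x_unique by (auto simp: X_def)
  have X_indep: "\<forall>(U, i)\<in>I. \<forall>u\<in>X \<inter> B U ! i. \<forall>v\<in>X \<inter> B U ! i. u = v"
  proof clarify
    fix U i u v assume "(U, i) \<in> I" "u \<in> X" "u \<in> B U ! i" "v \<in> X" "v \<in> B U ! i"
    then show "u = v" using X_unique[of u U i] X_unique[of v U i] by simp
  qed
  have "inj_on (\<lambda>(U, i). x U i) I"
  proof (rule inj_onI, clarify)
    fix U i U' j assume "(U, i) \<in> I" "(U', j) \<in> I" "x U i = x U' j"
    then show "U = U' \<and> i = j"
      using x_unique[of U i U' j] x[of U' j] by simp
  qed
  then have card_X: "card X = card W"
    by (simp add: X_def card_image card_I)
  have indep: "independent_set G T \<longleftrightarrow>
      T \<subseteq> {1..n} \<union> \<Union>\<C> \<and> (\<forall>u\<in>T \<inter> {1..n}. \<forall>v\<in>T \<inter> {1..n}. u = v) \<and>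
      (\<forall>(U, i)\<in>I. \<forall>u\<in>T \<inter> B U ! i. \<forall>v\<in>T \<inter> B U ! i. u = v)" for T
    unfolding G_eq independent_set_clique_union_iff \<C>_def[symmetric] unfolding C_eq by auto
  show thesis
  proof (cases "W = {1..n}")
    case True
    have cover: "{1..n} \<subseteq> \<Union>\<C>"
    proof
      fix w assume "w \<in> {1..n}"
      then obtain U where U: "U \<in> P" "w \<in> U"
        using True partition_onD1[OF P] by blast
      then obtain i where i: "i < length (us U)" "us U ! i = w"
        using fans[OF U(1)] by (metis in_set_conv_nth)
      then have I: "(U, i) \<in> I" using U(1) len(1)[OF U(1)] by (simp add: I_def)
      have "w \<in> set (take (Suc i) (us U))"
        using i by (auto simp: take_Suc_conv_app_nth)
      then have "w \<in> B U ! i" using base[OF I] by blast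
      then show "w \<in> \<Union>\<C>" using I by (auto simp: C_eq)
    qed
    show thesis
    proof (rule that[of X])
      show "independent_set G X"
        unfolding indep using X_old X_C X_indep by blast
      show "card X = (if W = {1..n} then n else card W + 1)"
        using True card_X by simp
      fix T assume T: "independent_set G T"
      have "card T \<le> card \<C>"
        by (rule card_independent_set_le_clique_cover)
          (use T cover \<open>finite I\<close> in \<open>auto simp: indep C_eq\<close>)
      then show "card T \<le> card X" using card_C card_X by simp
    qed
  next
    case False
    then obtain w where w: "w \<in> {1..n}" "w \<notin> W" using W by blast
    have w_C: "w \<notin> B U ! i" if "(U, i) \<in> I" for U i
    proof -
      have "set (take (Suc i) (us U)) \<subseteq> W"
        using set_take_subset[of "Suc i" "us U"] fans[of U] U_sub[of U] that by (auto simp: I_def)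
      then show ?thesis using base[OF that] w by blast
    qed
    have "finite X" using \<open>finite I\<close> by (simp add: X_def)
    show thesis
    proof (rule that[of "insert w X"])
      show "independent_set G (insert w X)"
        unfolding indep
      proof (intro conjI)
        show "insert w X \<subseteq> {1..n} \<union> \<Union>\<C>" using X_C w by blast
        show "\<forall>u\<in>insert w X \<inter> {1..n}. \<forall>v\<in>insert w X \<inter> {1..n}. u = v" using X_old by blast
        show "\<forall>(U, i)\<in>I. \<forall>u\<in>insert w X \<inter> B U ! i. \<forall>v\<in>insert w X \<inter> B U ! i. u = v"
          using w_C X_indep by (auto split: prod.splits)
      qed
      show card: "card (insert w X) = (if W = {1..n} then n else card W + 1)"
        using False card_X X_old w \<open>finite X\<close> by (subst card_insert_disjoint) auto
      fix T assume T: "independent_set G T"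
      have "card T \<le> card (insert {1..n} \<C>)"
        by (rule card_independent_set_le_clique_cover)
          (use T \<open>finite I\<close> in \<open>auto simp: indep C_eq\<close>)
      also have "\<dots> \<le> Suc (card \<C>)" by (rule card_insert_le_m1) auto
      finally show "card T \<le> card (insert w X)" using card_C card False by simp
    qed
  qed
qed

lemma fan_graph_finite:
  assumes "k_fan_graph n k W P G"
  shows "finite (verts G)" and "\<Union> (edges G) \<subseteq> verts G"
proof -
  have W: "finite W" and P: "partition_on W P"
    using assms by (auto simp: k_fan_graph_def intro: finite_subset[OF _ finite_atLeastAtMost])
  obtain us B where fans: "\<forall>U\<in>P. set (us U) = U \<and> fan_branch {1..n} (us U) (B U)"
    and G_eq: "G = graph_Union (complete_graph ` insert {1..n} (\<Union>U\<in>P. set (B U)))"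
    using assms unfolding k_fan_graph_def by (elim conjE exE) (rule that)
  have "finite C" if "U \<in> P" "C \<in> set (B U)" for U C
    using fans that by (fastforce simp: fan_branch_def in_set_conv_nth)
  then show "finite (verts G)"
    unfolding G_eq verts_clique_union using finite_elements[OF W P] by auto
  show "\<Union> (edges G) \<subseteq> verts G"
    by (auto simp: G_eq graph_Union_def complete_graph_def)
qed


section \<open>The dimension of a fan graph\<close>

theorem theorem2p4:
  fixes n k :: nat and W :: "nat set" and P :: "nat set set" and G :: "nat ugraph"
    and S :: "(nat, 'k::field) polynomial ring"
    and I\<^sub>G :: "(nat, 'k) polynomial set"
  assumes "n \<ge> 2"
    and "W \<subseteq> {1..n}"
    and "partition_on W P"
    and "k_fan_graph n k W P G"
    and "S = polynomial_ring (verts G)"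
    and "I\<^sub>G = edge_ideal G"
  shows "(W \<subset> {1..n} \<longrightarrow> krull_dim (S Quot I\<^sub>G) = ereal (real (card W + 1))) \<and>
         (W = {1..n} \<longrightarrow> krull_dim (S Quot I\<^sub>G) = ereal (real n))"
proof -
  obtain J where J: "independent_set G J" "\<And>T. independent_set G T \<Longrightarrow> card T \<le> card J"
    "card J = (if W = {1..n} then n else card W + 1)"
    using fan_graph_maximum_independent_set[OF assms(4)] by blast
  have "krull_dim (S Quot I\<^sub>G) = ereal (real (card J))"
    unfolding assms(5,6) by (rule krull_dim_edge_ideal[OF fan_graph_finite[OF assms(4)] J(1,2)])
  then show ?thesis
    by (auto simp: J(3))
qed

end
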